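(* Let $C$ be a circle graph, $r\ge1$ an integer, and $S$ an independent $r$-incident multiset of vertices of $C$. Then there exists an independent set $A\subseteq V(C)$ such that $C\star^r S = C\star^1 A$; in particular $C\star^r S$ is a circle graph. Equivalently, in terms of graph states: if $C$ is a circle graph and $G$ is a graph such that $|G\rangle$ is LU-equivalent to $|C\rangle$, then $|G\rangle$ is LC-equivalent to $|C\rangle$ and $G$ is a circle graph.
   Context: Graphs are finite, simple, undirected; $N_G(u)$ is the neighbourhood of $u$. A circle graph is a graph isomorphic to the intersection graph of a finite set of chords of a circle. A multiset $S$ of vertices is identified with its multiplicity function $S:V(G)\to\mathbb N$, with support $\mathrm{supp}(S)=\{u:S(u)\ge1\}$; it is independent if its support contains no two adjacent vertices. For $r\ge1$, $S$ is $r$-incident if for every $k\in\{0,\dots,r-1\}$ and every $K\subseteq V(G)\setminus\mathrm{supp}(S)$ with $|K|=k+2$, $\sum_{u\in\bigcap_{v\in K}N_G(v)}S(u)$ is a multiple of $2^{r-k-\delta(k)}$ ($\delta(0)=1$, $\delta(k)=0$ for $k\neq0$). For independent $r$-incident $S$, $G\star^r S$ is the graph on $V(G)$ where distinct $a,b$ are adjacent iff exactly one of: $a\sim_G b$; $\sum_{u\in N_G(a)\cap N_G(b)}S(u)\equiv 2^{r-1}\pmod{2^r}$. For an independent set $A=\{u_1,\dots,u_k\}$, $G\star^1 A=G\star u_1\star\cdots\star u_k$ where $G\star u$ complements the subgraph induced on $N_G(u)$. The graph state of a graph $G$ on $n$ vertices is $|G\rangle=\prod_{\{u,v\}\in E(G)}CZ_{uv}\,|+\rangle^{\otimes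 V(G)}$, with $|+\rangle=(|0\rangle+|1\rangle)/\sqrt2$ and $CZ|x_1x_2\rangle=(-1)^{x_1x_2}|x_1x_2\rangle$. Two states are LU-equivalent if one is obtained from the other by a tensor product of single-qubit unitaries, and LC-equivalent if this can be done, up to global phase, with a tensor product of single-qubit Clifford unitaries (unitaries normalizing the single-qubit Pauli group). Known fact (used for the equivalence): two graph states $|G\rangle,|G'\rangle$ are LU-equivalent iff $G'$ is obtained from $G$ by a sequence of valid $r$-local complementations (for various $r$), and LC-equivalent iff $G'$ is obtained from $G$ by a sequence of local complementations. *)

theory Defs
  imports "HOL-Analysis.Analysis"
begin

definition simple_graph :: "'a set \<Rightarrow> ('a \<Rightarrow> 'a \<Rightarrow> bool) \<Rightarrow> bool" where
  "simple_graph V E \<longleftrightarrow> finite V \<and> (\<forall>u v. E u v \<longrightarrow> E v u)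
     \<and> (\<forall>u. \<not> E u u) \<and> (\<forall>u v. E u v \<longrightarrow> u \<in> V \<and> v \<in> V)"

definition nbhd :: "'a set \<Rightarrow> ('a \<Rightarrow> 'a \<Rightarrow> bool) \<Rightarrow> 'a \<Rightarrow> 'a set" where
  "nbhd V E u = {v \<in> V. E u v}"

definition is_chord :: "complex \<Rightarrow> real \<Rightarrow> complex set \<Rightarrow> bool" where
  "is_chord c \<rho> X \<longleftrightarrow> (\<exists>p q. p \<in> sphere c \<rho> \<and> q \<in> sphere c \<rho> \<and> p \<noteq> q \<and> X = closed_segment p q)"

definition circle_graph :: "'a set \<Rightarrow> ('a \<Rightarrow> 'a \<Rightarrow> bool) \<Rightarrow> bool" where
  "circle_graph V E \<longleftrightarrow> (\<exists>c \<rho> f. \<rho> > 0 \<and> inj_on f V \<and> (\<forall>v\<in>V. is_chord c \<rho> (f v))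
      \<and> (\<forall>u\<in>V. \<forall>v\<in>V. u \<noteq> v \<longrightarrow> (E u v \<longleftrightarrow> f u \<inter> f v \<noteq> {})))"

text \<open>Multisets of vertices as multiplicity functions.\<close>

definition supp :: "('a \<Rightarrow> nat) \<Rightarrow> 'a set" where
  "supp S = {u. S u \<ge> 1}"

definition independent :: "('a \<Rightarrow> 'a \<Rightarrow> bool) \<Rightarrow> 'a set \<Rightarrow> bool" where
  "independent E A \<longleftrightarrow> (\<forall>u\<in>A. \<forall>v\<in>A. \<not> E u v)"

definition delta :: "nat \<Rightarrow> nat" where
  "delta k = (if k = 0 then 1 else 0)"

definition r_incident :: "'a set \<Rightarrow> ('a \<Rightarrow> 'a \<Rightarrow> bool) \<Rightarrow> nat \<Rightarrow> ('a \<Rightarrow> nat) \<Rightarrow> bool" where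
  "r_incident V E r S \<longleftrightarrow> (\<forall>k < r. \<forall>K. K \<subseteq> V - supp S \<and> card K = k + 2 \<longrightarrow>
      (2::nat) ^ (r - k - delta k) dvd (\<Sum>u\<in>(\<Inter>v\<in>K. nbhd V E v). S u))"

definition r_local_comp :: "'a set \<Rightarrow> ('a \<Rightarrow> 'a \<Rightarrow> bool) \<Rightarrow> nat \<Rightarrow> ('a \<Rightarrow> nat) \<Rightarrow> 'a \<Rightarrow> 'a \<Rightarrow> bool" where
  "r_local_comp V E r S a b \<longleftrightarrow> a \<in> V \<and> b \<in> V \<and> a \<noteq> b \<and>
     (E a b \<noteq> ((\<Sum>u\<in>nbhd V E a \<inter> nbhd V E b. S u) mod 2 ^ r = 2 ^ (r - 1)))"

definition local_comp :: "('a \<Rightarrow> 'a \<Rightarrow> bool) \<Rightarrow> 'a \<Rightarrow> 'a \<Rightarrow> 'a \<Rightarrow> bool" where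
  "local_comp E u a b \<longleftrightarrow> (if a \<noteq> b \<and> E u a \<and> E u b then \<not> E a b else E a b)"

definition local_comp_list :: "('a \<Rightarrow> 'a \<Rightarrow> bool) \<Rightarrow> 'a list \<Rightarrow> 'a \<Rightarrow> 'a \<Rightarrow> bool" where
  "local_comp_list E xs = fold (\<lambda>u F. local_comp F u) xs E"

end

theory Submission
  imports Defs
begin

text \<open>
  If three pairwise disjoint chords cross a common chord, any chord crossing the outer two also
  crosses the middle one. Hence, for an independent set of chords, the common neighbourhood inside it
  of four or more further chords is already that of some three of them, and \<open>r\<close>-incidence yields that
  every set \<open>K\<close> of at least two vertices has common weight divisible by \<open>2 ^ (r - 1)\<close>. By Moebius
  inversion the same holds for the total weight of the vertices of \<open>supp S\<close> whose neighbourhood is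
  exactly \<open>K\<close>. Choosing one vertex from each of these classes whose weight is an odd multiple of
  \<open>2 ^ (r - 1)\<close> gives \<open>A\<close>. A local complementation of a circle graph reflects one of the two arcs cut
  off by the corresponding chord, so it yields a circle graph again.
\<close>

subsection \<open>Crossing chords with distinct endpoints\<close>

definition in_arc :: "real \<Rightarrow> real \<Rightarrow> real \<Rightarrow> bool" where
  "in_arc a b x \<longleftrightarrow> (a < x) \<noteq> (b < x)"

text \<open>At the endpoints \<open>a\<close> and \<open>b\<close> themselves the value of \<^const>\<open>in_arc\<close> is an artefact of the
  exclusive-or form; crossings are only ever evaluated for four distinct points.\<close>

definition crossing :: "real \<Rightarrow> real \<Rightarrow> real \<Rightarrow> real \<Rightarrow> bool" where
  "crossing a b c d \<longleftrightarrow> in_arc a b c \<noteq> in_arc a b d"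

text \<open>The circle cut open to a line: each vertex is a chord with unordered ends
  \<open>p u\<close> and \<open>q u\<close>. All ends are distinct, and
  \<open>p u \<noteq> q u\<close> is the case \<open>u = v\<close> of the third conjunct.\<close>

definition chord_model :: "'a set \<Rightarrow> ('a \<Rightarrow> 'a \<Rightarrow> bool) \<Rightarrow> ('a \<Rightarrow> real) \<Rightarrow> ('a \<Rightarrow> real) \<Rightarrow> bool" where
  "chord_model V E p q \<longleftrightarrow> inj_on p V \<and> inj_on q V \<and> (\<forall>u\<in>V. \<forall>v\<in>V. p u \<noteq> q v) \<and>
     (\<forall>u\<in>V. \<forall>v\<in>V. u \<noteq> v \<longrightarrow> (E u v \<longleftrightarrow> crossing (p u) (q u) (p v) (q v)))"

lemma in_arc_commute: "in_arc b a x \<longleftrightarrow> in_arc a b x"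
  unfolding in_arc_def by blast

lemma crossing_commute:
  assumes "a \<noteq> c" "a \<noteq> d" "b \<noteq> c" "b \<noteq> d"
  shows "crossing a b c d \<longleftrightarrow> crossing c d a b"
  using assms unfolding crossing_def in_arc_def by (smt (verit))

text \<open>Each of the chords \<open>c d\<close> and \<open>e f\<close> stays on one side of the
  chord \<open>a b\<close>, and the two sides differ.\<close>

lemma separated_not_crossing:
  assumes "\<not> crossing a b c d" "\<not> crossing a b e f" "in_arc a b c \<noteq> in_arc a b e"
    and "distinct [a, b, c, d, e, f]"
  shows "\<not> crossing c d e f"
  using assms unfolding crossing_def in_arc_def distinct.simps list.set by (smt (verit))

text \<open>Of the three ends inside the arc, one lies between the other two. Its partner is outside
  the arc, hence compares alike with both of them, so its chord separates them.\<close>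

lemma middle_chord_oriented:
  assumes "in_arc a b x" "in_arc a b y" "in_arc a b z"
    and "\<not> in_arc a b x'" "\<not> in_arc a b y'" "\<not> in_arc a b z'"
    and "distinct [a, b, x, x', y, y', z, z']"
  shows "in_arc x x' y \<noteq> in_arc x x' z \<or> in_arc y y' x \<noteq> in_arc y y' z \<or>
    in_arc z z' x \<noteq> in_arc z z' y"
proof -
  have "x \<noteq> y" "y \<noteq> z" "x \<noteq> z" "x' \<noteq> a" "x' \<noteq> b" "y' \<noteq> a" "y' \<noteq> b" "z' \<noteq> a" "z' \<noteq> b"
    using assms(7) by auto
  then show ?thesis
    using assms(1-6) unfolding in_arc_def by (smt (verit))
qed

lemma middle_chord:
  assumes "crossing a b x x'" "crossing a b y y'" "crossing a b z z'"
    and "\<not> crossing x x' y y'" "\<not> crossing y y' z z'" "\<not> crossing x x' z z'"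
    and d: "distinct [a, b, x, x', y, y', z, z']"
  shows "in_arc x x' y \<noteq> in_arc x x' z \<or> in_arc y y' x \<noteq> in_arc y y' z \<or>
    in_arc z z' x \<noteq> in_arc z z' y"
proof -
  have "\<not> crossing y y' x x'" "\<not> crossing z z' y y'" "\<not> crossing z z' x x'"
    using assms(4-6) crossing_commute d by (metis distinct_length_2_or_more)+
  note nc = this assms(4-6)
  \<comment> \<open>Each chord crosses \<open>a b\<close>, so exactly one of its ends is in the arc;
    the capital letters rename that end as the unprimed one.\<close>
  define X where "X = (if in_arc a b x then x else x')"
  define X' where "X' = (if in_arc a b x then x' else x)"
  define Y where "Y = (if in_arc a b y then y else y')"
  define Y' where "Y' = (if in_arc a b y then y' else y)"
  define Z where "Z = (if in_arc a b z then z else z')"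
  define Z' where "Z' = (if in_arc a b z then z' else z)"
  have "in_arc a b X" "in_arc a b Y" "in_arc a b Z"
    "\<not> in_arc a b X'" "\<not> in_arc a b Y'" "\<not> in_arc a b Z'"
    using assms(1-3) unfolding crossing_def X_def X'_def Y_def Y'_def Z_def Z'_def by auto
  moreover have "distinct [a, b, X, X', Y, Y', Z, Z']"
    using d unfolding X_def X'_def Y_def Y'_def Z_def Z'_def by auto
  ultimately have "in_arc X X' Y \<noteq> in_arc X X' Z \<or> in_arc Y Y' X \<noteq> in_arc Y Y' Z \<or>
      in_arc Z Z' X \<noteq> in_arc Z Z' Y"
    by (rule middle_chord_oriented)
  moreover have "in_arc X X' t = in_arc x x' t" "in_arc Y Y' t = in_arc y y' t"
      "in_arc Z Z' t = in_arc z z' t" for t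
    unfolding X_def X'_def Y_def Y'_def Z_def Z'_def by (auto simp: in_arc_commute)
  \<comment> \<open>As the three chords do not cross, either end of one lies on the same side of
    another, so undoing the renaming changes nothing.\<close>
  moreover have "in_arc x x' Y = in_arc x x' y" "in_arc x x' Z = in_arc x x' z"
      "in_arc y y' X = in_arc y y' x" "in_arc y y' Z = in_arc y y' z"
      "in_arc z z' X = in_arc z z' x" "in_arc z z' Y = in_arc z z' y"
    using nc unfolding crossing_def X_def Y_def Z_def by auto
  ultimately show ?thesis by simp
qed

lemma chord_model_distinct:
  assumes "chord_model V E p q" "set us \<subseteq> V" "distinct us"
  shows "distinct (concat (map (\<lambda>u. [p u, q u]) us))"
  using assms(2,3)
proof (induction us)
  case (Cons u us)
  then have u: "u \<in> V" "set us \<subseteq> V" "u \<notin> set us" by auto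
  have "p u \<noteq> q v" "q u \<noteq> p v" if "v \<in> V" for v
    using assms(1) that u unfolding chord_model_def by metis+
  moreover have "p u \<noteq> p v" "q u \<noteq> q v" if "v \<in> set us" for v
    using assms(1) that u unfolding chord_model_def inj_on_def by (metis subsetD)+
  moreover have "distinct (concat (map (\<lambda>u. [p u, q u]) us))"
    using Cons by auto
  ultimately show ?case using u by fastforce
qed simp

text \<open>Three disjoint chords that all meet \<open>a\<close> are linearly ordered along \<open>a\<close>, and a chord meeting
  the two outer ones must meet the middle one.\<close>

lemma no_triple_with_private_non_neighbours:
  assumes m: "chord_model V E p q" and sym: "\<And>u v. E u v \<Longrightarrow> E v u"
    and V: "{x, y, z, a, b, c, d} \<subseteq> V" and I: "distinct [x, y, z]" "{a, b, c, d} \<inter> {x, y, z} = {}"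
    and ind: "\<not> E x y" "\<not> E y z" "\<not> E x z"
    and a: "E a x" "E a y" "E a z"
    and b: "\<not> E b x" "E b y" "E b z"
    and c: "E c x" "\<not> E c y" "E c z"
    and d: "E d x" "E d y" "\<not> E d z"
  shows False
proof -
  have cr: "crossing (p u) (q u) (p v) (q v) \<longleftrightarrow> E u v" if "u \<in> V" "v \<in> V" "u \<noteq> v" for u v
    using m that unfolding chord_model_def by blast
  \<comment> \<open>If \<open>x\<close> separates \<open>y\<close> from \<open>z\<close>, a chord
    \<open>w\<close> missing \<open>x\<close> lies on one side of \<open>x\<close> and cannot meet
    both.\<close>
  have mid: False if "w \<in> V" "{x, y, z} \<subseteq> V" "distinct [w, x, y, z]" "\<not> E x y" "\<not> E x z" 
      "\<not> E w x" "E w y" "E w z" "in_arc (p x) (q x) (p y) \<noteq> in_arc (p x) (q x) (p z)" for w x y z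
  proof -
    have "\<not> E x w" using that sym by blast
    have D: "distinct [p x, q x, p y, q y, p w, q w]" "distinct [p x, q x, p z, q z, p w, q w]"
      using chord_model_distinct[OF m, of "[x, y, w]"] chord_model_distinct[OF m, of "[x, z, w]"] that by auto
    have "\<not> crossing (p x) (q x) (p w) (q w)" "\<not> crossing (p x) (q x) (p y) (q y)" "\<not> crossing (p x) (q x) (p z) (q z)"
      using that \<open>\<not> E x w\<close> by (auto simp: cr)
    moreover have "crossing (p y) (q y) (p w) (q w)" "crossing (p z) (q z) (p w) (q w)"
      using that sym by (auto simp: cr)
    ultimately show False
      using separated_not_crossing[OF _ _ _ D(1)] separated_not_crossing[OF _ _ _ D(2)] that(9) by blast
  qed
  have ind': "\<not> E y x" "\<not> E z y" "\<not> E z x" using ind sym by blast+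
  have D: "distinct [p a, q a, p x, q x, p y, q y, p z, q z]"
    using chord_model_distinct[OF m, of "[a, x, y, z]"] V I by auto
  have "in_arc (p x) (q x) (p y) \<noteq> in_arc (p x) (q x) (p z) \<or>
      in_arc (p y) (q y) (p x) \<noteq> in_arc (p y) (q y) (p z) \<or>
      in_arc (p z) (q z) (p x) \<noteq> in_arc (p z) (q z) (p y)"
    using middle_chord[OF _ _ _ _ _ _ D] V I ind a by (auto simp: cr)
  \<comment> \<open>Whichever of \<open>x\<close>, \<open>y\<close>, \<open>z\<close> is the middle
    chord, one of \<open>b\<close>, \<open>c\<close>, \<open>d\<close> misses exactly that
    one.\<close>
  then show False
    using mid[of b x y z] mid[of c y x z] mid[of d z x y] V I ind ind' b c d by auto
qed

section \<open>Local complementation as reflection of an arc\<close>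

definition flip :: "real \<Rightarrow> real \<Rightarrow> real \<Rightarrow> real" where
  "flip a b x = (if in_arc a b x \<and> x \<noteq> a \<and> x \<noteq> b then a + b - x else x)"

lemma flip_eq_iff: "flip a b x = flip a b y \<longleftrightarrow> x = y"
  unfolding flip_def in_arc_def by (smt (verit))

text \<open>The open arc is an interval that its reflection maps onto itself: order is reversed
  inside it, and comparisons with points outside are unaffected.\<close>

lemma flip_less_iff:
  assumes "x \<noteq> y"
  shows "flip a b x < flip a b y \<longleftrightarrow>
    ((x < y) \<noteq> ((in_arc a b x \<and> x \<noteq> a \<and> x \<noteq> b) \<and> (in_arc a b y \<and> y \<noteq> a \<and> y \<noteq> b)))"
  using assms unfolding flip_def in_arc_def by (smt (verit))

text \<open>Reflecting the arc cut off by the chord \<open>u\<close> reverses the order of two endpoints exactly when both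
  lie in the arc. Summing modulo 2 over the four pairs of endpoints of \<open>v\<close> and \<open>w\<close>, the crossing of
  \<open>v\<close> and \<open>w\<close> changes iff each of them has exactly one endpoint in the arc, i.e. both cross \<open>u\<close>.\<close>

lemma chord_model_local_comp:
  assumes m: "chord_model V E p q" and u: "u \<in> V" and irr: "\<not> E u u"
  shows "chord_model V (local_comp E u) (flip (p u) (q u) \<circ> p) (flip (p u) (q u) \<circ> q)"
proof -
  let ?f = "flip (p u) (q u)"
  \<comment> \<open>\<open>in_arc\<close> is true at one of the two ends of \<open>u\<close>.
    Excluding both leaves \<open>u\<close> with no end inside, in accordance with
    irreflexivity.\<close>
  define ins where "ins x \<longleftrightarrow> in_arc (p u) (q u) x \<and> x \<noteq> p u \<and> x \<noteq> q u" for x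
  have ins: "E u v \<longleftrightarrow> ins (p v) \<noteq> ins (q v)" if "v \<in> V" for v
  proof (cases "v = u")
    case True
    then show ?thesis using irr by (simp add: ins_def)
  next
    case False
    then have "E u v \<longleftrightarrow> crossing (p u) (q u) (p v) (q v)"
      using m u that unfolding chord_model_def by metis
    moreover have "distinct [p u, q u, p v, q v]"
      using chord_model_distinct[OF m, of "[u, v]"] u that False by auto
    ultimately show ?thesis unfolding crossing_def ins_def by auto
  qed
  have "local_comp E u v w \<longleftrightarrow> crossing (?f (p v)) (?f (q v)) (?f (p w)) (?f (q w))"
    if "v \<in> V" "w \<in> V" "v \<noteq> w" for v w
  proof -
    have "distinct [p v, q v, p w, q w]"
      using chord_model_distinct[OF m, of "[v, w]"] that by auto
    then have "?f (p v) < ?f (p w) \<longleftrightarrow> (p v < p w) \<noteq> (ins (p v) \<and> ins (p w))"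
      "?f (p v) < ?f (q w) \<longleftrightarrow> (p v < q w) \<noteq> (ins (p v) \<and> ins (q w))"
      "?f (q v) < ?f (p w) \<longleftrightarrow> (q v < p w) \<noteq> (ins (q v) \<and> ins (p w))"
      "?f (q v) < ?f (q w) \<longleftrightarrow> (q v < q w) \<noteq> (ins (q v) \<and> ins (q w))"
      unfolding ins_def by (intro flip_less_iff; simp)+
    then have "crossing (?f (p v)) (?f (q v)) (?f (p w)) (?f (q w)) \<longleftrightarrow>
        crossing (p v) (q v) (p w) (q w) \<noteq> ((ins (p v) \<noteq> ins (q v)) \<and> (ins (p w) \<noteq> ins (q w)))"
      unfolding crossing_def in_arc_def by argo
    also have "crossing (p v) (q v) (p w) (q w) \<longleftrightarrow> E v w"
      using m that unfolding chord_model_def by blast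
    finally show ?thesis
      using that ins by (auto simp: local_comp_def)
  qed
  then show ?thesis
    using m unfolding chord_model_def inj_on_def o_def flip_eq_iff by blast
qed

subsection \<open>Chords of a circle\<close>

text \<open>Twice the signed area of the triangle \<open>p\<close>, \<open>q\<close>,
  \<open>z\<close>; positive iff \<open>z\<close> is to the left of the directed line from
  \<open>p\<close> to \<open>q\<close>.\<close>

definition orient :: "complex \<Rightarrow> complex \<Rightarrow> complex \<Rightarrow> real" where
  "orient p q z = Im (cnj (q - p) * (z - p))"

lemma orient_swap: "orient q p z = - orient p q z"
  by (simp add: orient_def algebra_simps)

lemma orient_on_segment:
  assumes "z \<in> closed_segment p q"
  shows "orient p q z = 0"
proof -
  obtain t where "z = (1 - t) *\<^sub>R p + t *\<^sub>R q"
    using assms by (auto simp: in_segment)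
  then have "z - p = t *\<^sub>R (q - p)" by (simp add: algebra_simps)
  then show ?thesis by (simp only: orient_def) (simp add: algebra_simps)
qed

lemma orient_convex_combination:
  "orient p q ((1 - t) *\<^sub>R x + t *\<^sub>R y) = (1 - t) * orient p q x + t * orient p q y"
  by (simp add: orient_def algebra_simps)

text \<open>\<open>orient p q\<close> is affine in its last argument, so it stays positive along the
  segment from \<open>x\<close> to \<open>y\<close>, while it vanishes on the segment from
  \<open>p\<close> to \<open>q\<close>.\<close>

lemma segments_disjoint_pos:
  assumes "orient p q x > 0" "orient p q y > 0"
  shows "closed_segment p q \<inter> closed_segment x y = {}"
proof -
  have "orient p q z > 0" if z: "z \<in> closed_segment x y" for z
  proof -
    obtain t where t: "0 \<le> t" "t \<le> 1" and "z = (1 - t) *\<^sub>R x + t *\<^sub>R y"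
      using z by (auto simp: in_segment)
    then have "orient p q z = (1 - t) * orient p q x + t * orient p q y"
      by (simp only: orient_convex_combination)
    also have "\<dots> > 0"
      using t assms by (cases "t = 0") (auto intro!: add_nonneg_pos)
    finally show ?thesis .
  qed
  then show ?thesis using orient_on_segment by force
qed

lemma segments_disjoint_neg:
  assumes "orient p q x < 0" "orient p q y < 0"
  shows "closed_segment p q \<inter> closed_segment x y = {}"
  using segments_disjoint_pos[of q p x y] assms by (simp add: orient_swap[of q p] closed_segment_commute)

text \<open>The triangle areas are the coefficients of the affine dependence between the four
  corners. Sorting it by diagonals writes one point as a convex combination of \<open>a\<close>,
  \<open>c\<close> and also of \<open>b\<close>, \<open>d\<close>.\<close>

lemma diagonals_meet:
  assumes "orient a b c > 0" "orient b c d > 0" "orient a c d > 0" "orient a b d > 0"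
  shows "closed_segment a c \<inter> closed_segment b d \<noteq> {}"
proof -
  let ?A = "orient b c d" and ?B = "orient a c d" and ?C = "orient a b d" and ?D = "orient a b c"
  have s: "?A + ?C = ?B + ?D" by (simp add: orient_def algebra_simps)
  have w: "?A *\<^sub>R a + ?C *\<^sub>R c = ?B *\<^sub>R b + ?D *\<^sub>R d"
    by (simp add: orient_def complex_eq_iff algebra_simps)
  have pt: "(1 - v / (u + v)) *\<^sub>R x + (v / (u + v)) *\<^sub>R y = (1 / (u + v)) *\<^sub>R (u *\<^sub>R x + v *\<^sub>R y)"
    if "u > 0" "v > 0" for u v and x y :: complex
    using that by (simp add: complex_eq_iff field_simps)
  have mem: "(1 / (u + v)) *\<^sub>R (u *\<^sub>R x + v *\<^sub>R y) \<in> closed_segment x y"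
    if "u > 0" "v > 0" for u v and x y :: complex
    unfolding in_segment using pt[OF that] that by (intro exI[of _ "v / (u + v)"]) auto
  have "(1 / (?A + ?C)) *\<^sub>R (?A *\<^sub>R a + ?C *\<^sub>R c) \<in> closed_segment a c"
    using assms by (intro mem)
  moreover have "(1 / (?A + ?C)) *\<^sub>R (?A *\<^sub>R a + ?C *\<^sub>R c) \<in> closed_segment b d"
    unfolding s w using assms by (intro mem)
  ultimately show ?thesis by blast
qed

definition circ :: "complex \<Rightarrow> real \<Rightarrow> real \<Rightarrow> complex" where
  "circ c \<rho> t = c + of_real \<rho> * cis t"

text \<open>The area formula for an inscribed triangle in terms of its angles, with sign, obtained
  from the sum-to-product identities.\<close>

lemma orient_circ:
  "orient (circ c \<rho> a) (circ c \<rho> b) (circ c \<rho> t) =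
     4 * \<rho>\<^sup>2 * sin ((b - a) / 2) * sin ((t - b) / 2) * sin ((t - a) / 2)"
proof -
  have "orient (circ c \<rho> a) (circ c \<rho> b) (circ c \<rho> t) =
      \<rho>\<^sup>2 * ((cos b - cos a) * (sin t - sin a) - (sin b - sin a) * (cos t - cos a))"
    by (simp add: orient_def circ_def algebra_simps power2_eq_square)
  also have "(cos b - cos a) * (sin t - sin a) - (sin b - sin a) * (cos t - cos a) =
     (2 * sin ((b + a) / 2) * sin ((a - b) / 2)) * (2 * sin ((t - a) / 2) * cos ((t + a) / 2))
     - (2 * sin ((b - a) / 2) * cos ((b + a) / 2)) * (2 * sin ((t + a) / 2) * sin ((a - t) / 2))"
    by (simp only: sin_diff_sin cos_diff_cos)
  also have "sin ((a - b) / 2) = - sin ((b - a) / 2)"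
    by (metis minus_diff_eq minus_divide_left sin_minus)
  also have "sin ((a - t) / 2) = - sin ((t - a) / 2)"
    by (metis minus_diff_eq minus_divide_left sin_minus)
  also have "(2 * sin ((b + a) / 2) * - sin ((b - a) / 2)) * (2 * sin ((t - a) / 2) * cos ((t + a) / 2))
     - (2 * sin ((b - a) / 2) * cos ((b + a) / 2)) * (2 * sin ((t + a) / 2) * - sin ((t - a) / 2))
     = 4 * sin ((b - a) / 2) * sin ((t - a) / 2) * (sin ((t + a) / 2) * cos ((b + a) / 2) - cos ((t + a) / 2) * sin ((b + a) / 2))"
    by (simp add: algebra_simps)
  also have "sin ((t + a) / 2) * cos ((b + a) / 2) - cos ((t + a) / 2) * sin ((b + a) / 2) = sin ((t - b) / 2)"
    using sin_diff[of "(t + a) / 2" "(b + a) / 2"] by (simp add: diff_divide_distrib[symmetric])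
  finally show ?thesis by (simp add: algebra_simps)
qed

lemma sin_half_pos: "0 < x \<Longrightarrow> x < 2 * pi \<Longrightarrow> sin (x / 2) > 0"
  by (intro sin_gt_zero) auto

lemma sin_half_neg: "x < 0 \<Longrightarrow> - 2 * pi < x \<Longrightarrow> sin (x / 2) < 0"
  using sin_half_pos[of "- x"] by simp

text \<open>Half-differences of angles in \<open>[0, 2 * pi)\<close> lie strictly between
  \<open>- pi\<close> and \<open>pi\<close>, so each sine in \<open>orient_circ\<close> has the sign
  of its argument; for \<open>t\<close> outside the interval the two factors involving
  \<open>t\<close> agree in sign.\<close>

lemma orient_circ_pos:
  assumes "\<rho> > 0" "0 \<le> a" "a < b" "b < 2 * pi" "0 \<le> t" "t < a \<or> b < t" "t < 2 * pi"
  shows "orient (circ c \<rho> a) (circ c \<rho> b) (circ c \<rho> t) > 0"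
proof -
  have "sin ((b - a) / 2) > 0" using assms by (intro sin_half_pos) auto
  moreover have "sin ((t - b) / 2) * sin ((t - a) / 2) > 0"
  proof (cases "t < a")
    case True
    then show ?thesis using assms by (intro mult_neg_neg sin_half_neg) auto
  next
    case False
    then show ?thesis using assms by (intro mult_pos_pos sin_half_pos) auto
  qed
  ultimately show ?thesis using assms(1) by (simp add: orient_circ mult.assoc)
qed

lemma orient_circ_neg:
  assumes "\<rho> > 0" "0 \<le> a" "a < t" "t < b" "b < 2 * pi"
  shows "orient (circ c \<rho> a) (circ c \<rho> b) (circ c \<rho> t) < 0"
proof -
  have "sin ((b - a) / 2) > 0" using assms by (intro sin_half_pos) auto
  moreover have "sin ((t - b) / 2) * sin ((t - a) / 2) < 0"
    using assms by (intro mult_neg_pos sin_half_neg sin_half_pos) auto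
  ultimately show ?thesis using assms(1) by (simp add: orient_circ mult.assoc mult_less_0_iff)
qed

definition chord :: "complex \<Rightarrow> real \<Rightarrow> real \<Rightarrow> real \<Rightarrow> complex set" where
  "chord c \<rho> l r = closed_segment (circ c \<rho> l) (circ c \<rho> r)"

text \<open>The inequalities are weak because chords with a common endpoint meet. Four distinct
  interlaced ends form a convex quadrilateral with the chords as diagonals.\<close>

lemma chords_meet_iff:
  assumes "\<rho> > 0" "0 \<le> l" "l < r" "r < 2 * pi" "0 \<le> l'" "l' < r'" "r' < 2 * pi"
  shows "chord c \<rho> l r \<inter> chord c \<rho> l' r' \<noteq> {} \<longleftrightarrow>
    l \<le> l' \<and> l' \<le> r \<and> r \<le> r' \<or> l' \<le> l \<and> l \<le> r' \<and> r' \<le> r" (is "?M \<longleftrightarrow> ?I l r l' r' \<or> ?I l' r' l r")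
proof
  assume M: ?M
  show "?I l r l' r' \<or> ?I l' r' l r"
  proof (rule ccontr)
    assume "\<not> ?thesis"
    \<comment> \<open>Without interlacing, the angle intervals are disjoint or strictly nested, and
      one chord lies on one side of the line through the other.\<close>
    then consider "r < l' \<or> r' < l" | "l < l' \<and> r' < r" | "l' < l \<and> r < r'" using assms by argo
    then have "chord c \<rho> l r \<inter> chord c \<rho> l' r' = {}"
    proof cases
      case 1
      then show ?thesis using assms unfolding chord_def
        by (intro segments_disjoint_pos orient_circ_pos) auto
    next
      case 2
      then show ?thesis using assms unfolding chord_def
        by (intro segments_disjoint_neg orient_circ_neg) auto
    next
      case 3
      then have "chord c \<rho> l' r' \<inter> chord c \<rho> l r = {}" using assms unfolding chord_def
        by (intro segments_disjoint_neg orient_circ_neg) auto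
      then show ?thesis by blast
    qed
    with M show False by blast
  qed
next
  have meet: "chord c \<rho> l r \<inter> chord c \<rho> l' r' \<noteq> {}"
    if "?I l r l' r'" "0 \<le> l" "l < r" "l' < r'" "r' < 2 * pi" for l r l' r'
  proof (cases "l = l' \<or> l' = r \<or> r = r'")
    case True
    then show ?thesis unfolding chord_def using ends_in_segment by blast
  next
    case False
    then show ?thesis unfolding chord_def using that assms(1)
      by (intro diagonals_meet orient_circ_pos) auto
  qed
  assume "?I l r l' r' \<or> ?I l' r' l r"
  then show ?M
  proof
    assume "?I l r l' r'"
    then show ?M using meet assms by simp
  next
    assume "?I l' r' l r"
    then have "chord c \<rho> l' r' \<inter> chord c \<rho> l r \<noteq> {}" using meet assms by simp
    then show ?M by (simp add: Int_commute)
  qed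
qed

lemma circ_in_sphere: "\<rho> > 0 \<Longrightarrow> circ c \<rho> t \<in> sphere c \<rho>"
  by (simp add: circ_def dist_norm norm_mult)

lemma circ_eq_iff:
  assumes "\<rho> > 0" "0 \<le> a" "a < 2 * pi" "0 \<le> b" "b < 2 * pi"
  shows "circ c \<rho> a = circ c \<rho> b \<longleftrightarrow> a = b"
proof
  assume "circ c \<rho> a = circ c \<rho> b"
  then have "cis a = cis b" using assms(1) by (simp add: circ_def)
  moreover have "Arg2pi (cis t) = t" if "0 \<le> t" "t < 2 * pi" for t
    using Arg2pi_unique[of 1 t "cis t"] that by (simp add: cis_conv_exp)
  ultimately show "a = b" using assms by metis
qed simp

lemma sphere_circ:
  assumes "z \<in> sphere c \<rho>" "\<rho> > 0"
  obtains t where "0 \<le> t" "t < 2 * pi" "z = circ c \<rho> t"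
proof
  have "norm (z - c) = \<rho>" using assms by (simp add: dist_norm norm_minus_commute)
  then have "z - c = of_real \<rho> * cis (Arg2pi (z - c))"
    using Arg2pi_eq[of "z - c"] by (simp add: cis_conv_exp)
  then show "z = circ c \<rho> (Arg2pi (z - c))" by (simp add: circ_def algebra_simps)
qed (auto simp: Arg2pi_ge_0 Arg2pi_lt_2pi)

lemma is_chord_chord:
  assumes "\<rho> > 0" "0 \<le> l" "l < r" "r < 2 * pi"
  shows "is_chord c \<rho> (chord c \<rho> l r)"
  unfolding is_chord_def chord_def using assms circ_in_sphere circ_eq_iff[of \<rho> l r c]
  by (intro exI[of _ "circ c \<rho> l"] exI[of _ "circ c \<rho> r"]) auto

lemma is_chordE:
  assumes "is_chord c \<rho> X" "\<rho> > 0"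
  obtains l r where "0 \<le> l" "l < r" "r < 2 * pi" "X = chord c \<rho> l r"
proof -
  obtain x y where xy: "x \<in> sphere c \<rho>" "y \<in> sphere c \<rho>" "x \<noteq> y" "X = closed_segment x y"
    using assms(1) unfolding is_chord_def by blast
  obtain s where s: "0 \<le> s" "s < 2 * pi" "x = circ c \<rho> s" using xy(1) assms(2) by (rule sphere_circ)
  obtain t where t: "0 \<le> t" "t < 2 * pi" "y = circ c \<rho> t" using xy(2) assms(2) by (rule sphere_circ)
  have "s \<noteq> t" using s t xy(3) by blast
  then have "s < t \<or> t < s" by linarith
  moreover have "X = chord c \<rho> s t" "X = chord c \<rho> t s"
    using s t xy(4) by (simp_all add: chord_def closed_segment_commute)
  ultimately show thesis using s t that by blast
qed

lemma chord_eq_imp: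
  assumes "chord c \<rho> l r = chord c \<rho> l' r'" "\<rho> > 0" "0 \<le> l" "l < 2 * pi"
    "0 \<le> l'" "l' < 2 * pi" "0 \<le> r'" "r' < 2 * pi"
  shows "l = l' \<or> l = r'"
proof -
  have "circ c \<rho> l = circ c \<rho> l' \<or> circ c \<rho> l = circ c \<rho> r'"
    using assms(1) unfolding chord_def closed_segment_eq by (auto simp: doubleton_eq_iff)
  then show ?thesis using circ_eq_iff assms by metis
qed

section \<open>Passing between circle graphs and chord models\<close>

lemma circle_graph_of_chord_model:
  assumes m: "chord_model V E p q"
  shows "circle_graph V E"
proof -
  \<comment> \<open>A strictly increasing map of the real line into
    \<open>(pi / 2, 3 * pi / 2)\<close>: the order of the ends becomes the order of the
    angles.\<close>
  define g where "g x = arctan x + pi" for x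
  have g: "0 \<le> g x" "g x < 2 * pi" for x
    using arctan_lbound[of x] arctan_ubound[of x] pi_gt_zero unfolding g_def by linarith+
  have mono: "g x < g y \<longleftrightarrow> x < y" for x y by (simp add: g_def arctan_less_iff)
  have mono': "g x \<le> g y \<longleftrightarrow> x \<le> y" for x y by (simp add: g_def arctan_le_iff)
  have eq: "g x = g y \<longleftrightarrow> x = y" for x y by (simp add: g_def arctan_eq_iff)
  define l where "l v = min (p v) (q v)" for v
  define r where "r v = max (p v) (q v)" for v
  define f where "f v = chord 0 1 (g (l v)) (g (r v))" for v
  have lr: "l v < r v" if "v \<in> V" for v
    using m that unfolding chord_model_def l_def r_def by force
  have d: "distinct [p u, q u, p v, q v]" if "u \<in> V" "v \<in> V" "u \<noteq> v" for u v
    using chord_model_distinct[OF m, of "[u, v]"] that by auto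
  have "inj_on f V"
  proof (rule inj_onI, rule ccontr)
    fix u v assume uv: "u \<in> V" "v \<in> V" "f u = f v" "u \<noteq> v"
    then have "l u = l v \<or> l u = r v"
      using chord_eq_imp[of 0 1 "g (l u)" "g (r u)" "g (l v)" "g (r v)"] g eq unfolding f_def by auto
    then show False using d[OF uv(1,2,4)] unfolding l_def r_def min_def max_def by (auto split: if_splits)
  qed
  moreover have "is_chord 0 1 (f v)" if "v \<in> V" for v
    unfolding f_def using lr[OF that] g by (intro is_chord_chord) (auto simp: mono)
  moreover have "E u v \<longleftrightarrow> f u \<inter> f v \<noteq> {}" if "u \<in> V" "v \<in> V" "u \<noteq> v" for u v
  proof -
    have "f u \<inter> f v \<noteq> {} \<longleftrightarrow> l u \<le> l v \<and> l v \<le> r u \<and> r u \<le> r v \<or> l v \<le> l u \<and> l u \<le> r v \<and> r v \<le> r u"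
      unfolding f_def using chords_meet_iff[of 1 "g (l u)" "g (r u)" "g (l v)" "g (r v)" 0] lr that g
      by (simp add: mono mono')
    \<comment> \<open>The four ends are distinct, so weak interlacing is strict.\<close>
    also have "\<dots> \<longleftrightarrow> crossing (p u) (q u) (p v) (q v)"
      using d[OF that] unfolding l_def r_def crossing_def in_arc_def min_def max_def distinct.simps list.set
      by (smt (verit) insert_iff)
    also have "\<dots> \<longleftrightarrow> E u v" using m that unfolding chord_model_def by blast
    finally show ?thesis by blast
  qed
  ultimately show ?thesis unfolding circle_graph_def by (intro exI[of _ 0] exI[of _ 1] exI[of _ f]) auto
qed

text \<open>The comparison is lexicographic: the shifts differ by at most
  \<open>18 * \<epsilon>\<close>, less than any gap between different base points. The bound 18
  suits shifts \<open>s\<close>, \<open>t\<close> in \<open>[-10, 8)\<close>, the range that occurs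
  below.\<close>

lemma perturbed_less_iff:
  fixes x y s t \<epsilon> :: real
  assumes "\<epsilon> > 0" "\<bar>s - t\<bar> \<le> 18" "x \<noteq> y \<longrightarrow> \<bar>x - y\<bar> > 18 * \<epsilon>"
  shows "x + \<epsilon> * s < y + \<epsilon> * t \<longleftrightarrow> x < y \<or> x = y \<and> s < t"
proof -
  have "\<bar>\<epsilon> * s - \<epsilon> * t\<bar> = \<epsilon> * \<bar>s - t\<bar>"
    using assms(1) by (simp add: abs_mult flip: right_diff_distrib)
  also have "\<dots> \<le> \<epsilon> * 18" using assms(1,2) by (intro mult_left_mono) auto
  finally have "\<bar>\<epsilon> * s - \<epsilon> * t\<bar> \<le> 18 * \<epsilon>" by simp
  then show ?thesis using assms(1,3) by (cases "x = y") (simp, linarith)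
qed

lemma finite_gap:
  fixes X :: "real set"
  assumes "finite X"
  obtains \<epsilon> where "\<epsilon> > 0" "\<And>x y. x \<in> X \<Longrightarrow> y \<in> X \<Longrightarrow> x \<noteq> y \<Longrightarrow> \<bar>x - y\<bar> > k * \<epsilon>"
proof -
  \<comment> \<open>The extra 1 keeps the minimum defined when \<open>X\<close> has fewer than two
    elements.\<close>
  let ?D = "insert 1 ((\<lambda>(x, y). \<bar>x - y\<bar>) ` (X \<times> X) - {0})"
  have D: "finite ?D" using assms by simp
  have pos: "Min ?D > 0" using D by (subst Min_gr_iff) auto
  define \<epsilon> where "\<epsilon> = Min ?D / (\<bar>k\<bar> + 1)"
  have e: "\<epsilon> > 0" unfolding \<epsilon>_def using pos by (intro divide_pos_pos) auto
  have "k * \<epsilon> < (\<bar>k\<bar> + 1) * \<epsilon>" using e by (intro mult_strict_right_mono) auto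
  also have "\<dots> = Min ?D" unfolding \<epsilon>_def by (simp add: field_simps)
  finally have ke: "k * \<epsilon> < Min ?D" .
  have "k * \<epsilon> < \<bar>x - y\<bar>" if "x \<in> X" "y \<in> X" "x \<noteq> y" for x y
  proof -
    have "\<bar>x - y\<bar> \<in> ?D" using that by force
    then have "Min ?D \<le> \<bar>x - y\<bar>" using D by (rule Min_le[rotated])
    then show ?thesis using ke by simp
  qed
  then show thesis using that e by blast
qed

text \<open>Chords sharing an endpoint count as intersecting, so ties have to be broken into crossings: at a
  common point left endpoints precede right ones, and endpoints of the same kind are ordered by their
  opposite ends. The shift by 10 puts all left endpoints first because every angle is below 8.\<close>

lemma chord_model_of_circle_graph:
  assumes "circle_graph V E" "finite V"
  obtains p q where "chord_model V E p q"
proof -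
  obtain c \<rho> f where \<rho>: "\<rho> > 0" and inj: "inj_on f V" and ch: "\<forall>v\<in>V. is_chord c \<rho> (f v)"
    and E: "\<forall>u\<in>V. \<forall>v\<in>V. u \<noteq> v \<longrightarrow> (E u v \<longleftrightarrow> f u \<inter> f v \<noteq> {})"
    using assms(1) unfolding circle_graph_def by (elim exE conjE) (rule that)
  have "\<exists>l r. 0 \<le> l \<and> l < r \<and> r < 2 * pi \<and> f v = chord c \<rho> l r" if "v \<in> V" for v
    using is_chordE[OF bspec[OF ch that] \<rho>] by blast
  then obtain l r where lr: "\<And>v. v \<in> V \<Longrightarrow> 0 \<le> l v \<and> l v < r v \<and> r v < 2 * pi \<and> f v = chord c \<rho> (l v) (r v)"
    by metis
  have bd: "0 \<le> l v" "l v < r v" "r v < 2 * pi" "r v < 8" and f: "f v = chord c \<rho> (l v) (r v)" if "v \<in> V" for v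
    using lr[OF that] pi_less_4 by auto
  have "finite (l ` V \<union> r ` V)" using assms(2) by simp
  then obtain \<epsilon> where e: "\<epsilon> > 0"
    and gap: "\<And>x y. x \<in> l ` V \<union> r ` V \<Longrightarrow> y \<in> l ` V \<union> r ` V \<Longrightarrow> x \<noteq> y \<Longrightarrow> \<bar>x - y\<bar> > 18 * \<epsilon>"
    by (rule finite_gap[where k = 18]) blast
  define p where "p v = l v + \<epsilon> * (r v - 10)" for v
  define q where "q v = r v + \<epsilon> * l v" for v
  have cmp: "p u < p v \<longleftrightarrow> l u < l v \<or> l u = l v \<and> r u < r v"
     "p u < q v \<longleftrightarrow> l u \<le> r v"
     "q u < p v \<longleftrightarrow> r u < l v"
     "q u < q v \<longleftrightarrow> r u < r v \<or> r u = r v \<and> l u < l v"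
    if "u \<in> V" "v \<in> V" for u v
  proof -
    note b = bd[OF that(1)] bd[OF that(2)]
    have g: "l u \<noteq> l v \<longrightarrow> \<bar>l u - l v\<bar> > 18 * \<epsilon>" "l u \<noteq> r v \<longrightarrow> \<bar>l u - r v\<bar> > 18 * \<epsilon>"
       "r u \<noteq> l v \<longrightarrow> \<bar>r u - l v\<bar> > 18 * \<epsilon>" "r u \<noteq> r v \<longrightarrow> \<bar>r u - r v\<bar> > 18 * \<epsilon>"
      using gap that by blast+
    show "p u < p v \<longleftrightarrow> l u < l v \<or> l u = l v \<and> r u < r v"
      unfolding p_def using perturbed_less_iff[OF e _ g(1), of "r u - 10" "r v - 10"] b by auto
    show "p u < q v \<longleftrightarrow> l u \<le> r v"
      unfolding p_def q_def using perturbed_less_iff[OF e _ g(2), of "r u - 10" "l v"] b by auto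
    show "q u < p v \<longleftrightarrow> r u < l v"
      unfolding p_def q_def using perturbed_less_iff[OF e _ g(3), of "l u" "r v - 10"] b by auto
    show "q u < q v \<longleftrightarrow> r u < r v \<or> r u = r v \<and> l u < l v"
      unfolding q_def using perturbed_less_iff[OF e _ g(4), of "l u" "l v"] b by auto
  qed
  \<comment> \<open>Distinct vertices have distinct chords, so the lexicographic comparisons never
    end in a tie.\<close>
  have ne: "\<not> (l u = l v \<and> r u = r v)" if "u \<in> V" "v \<in> V" "u \<noteq> v" for u v
    using inj_onD[OF inj] f that by metis
  have "inj_on p V"
    by (rule inj_onI) (metis cmp(1) ne less_irrefl linorder_neqE_linordered_idom)
  moreover have "inj_on q V"
    by (rule inj_onI) (metis cmp(4) ne less_irrefl linorder_neqE_linordered_idom)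
  moreover have "p u \<noteq> q v" if "u \<in> V" "v \<in> V" for u v
    using cmp(2)[OF that] cmp(3)[OF that(2,1)] by force
  moreover have "E u v \<longleftrightarrow> crossing (p u) (q u) (p v) (q v)" if uv: "u \<in> V" "v \<in> V" "u \<noteq> v" for u v
  proof -
    have "E u v \<longleftrightarrow> l u \<le> l v \<and> l v \<le> r u \<and> r u \<le> r v \<or> l v \<le> l u \<and> l u \<le> r v \<and> r v \<le> r u"
      using E uv f chords_meet_iff[OF \<rho> bd(1-3)[OF uv(1)] bd(1-3)[OF uv(2)], of c] by simp
    also have "\<dots> \<longleftrightarrow> crossing (p u) (q u) (p v) (q v)"
      unfolding crossing_def in_arc_def cmp[OF uv(1,2)]
      using ne[OF uv] bd(2)[OF uv(1)] bd(2)[OF uv(2)] by (smt (verit))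
    finally show ?thesis .
  qed
  ultimately have "chord_model V E p q" unfolding chord_model_def by blast
  then show thesis by (rule that)
qed

subsection \<open>Divisibility of common weights\<close>

text \<open>Otherwise each of four members of \<open>K\<close> is the only member of
  \<open>K\<close> missing some vertex of \<open>I\<close>. Three such witnesses together with the
  four members form the excluded configuration.\<close>

lemma redundant_chord:
  assumes m: "chord_model V E p q" and sym: "\<And>u v. E u v \<Longrightarrow> E v u"
    and I: "I \<subseteq> V" "independent E I" and K: "K \<subseteq> V - I" "card K \<ge> 4"
  shows "\<exists>v\<in>K. \<forall>u\<in>I. (\<forall>w\<in>K - {v}. E w u) \<longrightarrow> E v u"
proof (rule ccontr)
  assume "\<not> ?thesis"
  then have ex: "\<exists>u\<in>I. (\<forall>w\<in>K - {v}. E w u) \<and> \<not> E v u" if "v \<in> K" for v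
    using that by blast
  obtain T where T: "T \<subseteq> K" "card T = 4" using K(2) by (meson obtain_subset_with_card_n)
  then obtain a b c d where abcd: "T = {a, b, c, d}" "distinct [a, b, c, d]"
    by (auto simp: card_Suc_eq numeral_eq_Suc)
  have K': "a \<in> K" "b \<in> K" "c \<in> K" "d \<in> K" using T abcd by auto
  \<comment> \<open>Witnesses are taken for \<open>b\<close>, \<open>c\<close> and \<open>d\<close>;
    the chord \<open>a\<close> is the transversal meeting all three.\<close>
  obtain x where x: "x \<in> I" "\<forall>w\<in>K - {b}. E w x" "\<not> E b x" using ex[OF K'(2)] by blast
  obtain y where y: "y \<in> I" "\<forall>w\<in>K - {c}. E w y" "\<not> E c y" using ex[OF K'(3)] by blast
  obtain z where z: "z \<in> I" "\<forall>w\<in>K - {d}. E w z" "\<not> E d z" using ex[OF K'(4)] by blast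
  have ax: "E a x" "E c x" "E d x" using x K' abcd(2) by auto
  have ay: "E a y" "E b y" "E d y" using y K' abcd(2) by auto
  have az: "E a z" "E b z" "E c z" using z K' abcd(2) by auto
  show False
  proof (rule no_triple_with_private_non_neighbours[OF m])
    show "E v u" if "E u v" for u v using that by (rule sym)
    show "{x, y, z, a, b, c, d} \<subseteq> V" using x y z K' K(1) I(1) by auto
    show "distinct [x, y, z]" using x(3) y(3) z(3) ax ay az by auto
    show "{a, b, c, d} \<inter> {x, y, z} = {}" using x(1) y(1) z(1) K' K(1) by auto
    show "\<not> E x y" "\<not> E y z" "\<not> E x z" using I(2) x y z unfolding independent_def by auto
  qed (rule ax ay az x(3) y(3) z(3))+
qed

text \<open>For two or three vertices this is \<open>r\<close>-incidence with \<open>k = 0\<close>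
  or \<open>k = 1\<close>: in both cases the exponent \<open>r - k - delta k\<close> is
  \<open>r - 1\<close>. A larger \<open>K\<close> loses a redundant vertex without changing the
  weight.\<close>

lemma common_weight_dvd:
  assumes m: "chord_model V E p q" and G: "simple_graph V E"
    and S: "supp S \<subseteq> V" "independent E (supp S)" "r_incident V E r S"
  shows "K \<subseteq> V - supp S \<Longrightarrow> card K \<ge> 2 \<Longrightarrow> (2::nat) ^ (r - 1) dvd (\<Sum>u\<in>(\<Inter>v\<in>K. nbhd V E v). S u)"
proof (induction "card K" arbitrary: K rule: less_induct)
  case less
  have finV: "finite V" and sym: "\<And>u v. E u v \<Longrightarrow> E v u"
    using G unfolding simple_graph_def by blast+
  show ?case
  proof (cases "r \<le> 1 \<or> card K \<le> 3")
    case True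
    then consider "r \<le> 1" | "1 < r" "card K = 0 + 2" | "1 < r" "card K = 1 + 2" using less.prems by linarith
    then show ?thesis
    proof cases
      case 1
      then show ?thesis by simp
    next
      case 2
      then have "(2::nat) ^ (r - 0 - delta 0) dvd (\<Sum>u\<in>(\<Inter>v\<in>K. nbhd V E v). S u)"
        using S(3) less.prems unfolding r_incident_def by (metis less_trans zero_less_one)
      then show ?thesis by (simp add: delta_def)
    next
      case 3
      then have "(2::nat) ^ (r - 1 - delta 1) dvd (\<Sum>u\<in>(\<Inter>v\<in>K. nbhd V E v). S u)"
        using S(3) less.prems unfolding r_incident_def by metis
      then show ?thesis by (simp add: delta_def)
    qed
  next
    case False
    then have K4: "card K \<ge> 4" by simp
    obtain v where v: "v \<in> K" "\<And>u. u \<in> supp S \<Longrightarrow> \<forall>w\<in>K - {v}. E w u \<Longrightarrow> E v u"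
      using redundant_chord[OF m sym S(1,2) less.prems(1) K4] by blast
    have cardK: "card (K - {v}) = card K - 1" using v(1) by simp
    then have "K - {v} \<noteq> {}" using K4 by (intro notI) simp
    then have sub: "(\<Inter>w\<in>K - {v}. nbhd V E w) \<subseteq> V" by (auto simp: nbhd_def)
    \<comment> \<open>Removing \<open>v\<close> from \<open>K\<close> can only add vertices outside
      \<open>supp S\<close>, whose weight is 0.\<close>
    have "(\<Sum>u\<in>(\<Inter>w\<in>K. nbhd V E w). S u) = (\<Sum>u\<in>(\<Inter>w\<in>K - {v}. nbhd V E w). S u)"
    proof (rule sum.mono_neutral_left)
      show "finite (\<Inter>w\<in>K - {v}. nbhd V E w)" using sub finV by (rule finite_subset)
      show "(\<Inter>w\<in>K. nbhd V E w) \<subseteq> (\<Inter>w\<in>K - {v}. nbhd V E w)" by blast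
      show "\<forall>u\<in>(\<Inter>w\<in>K - {v}. nbhd V E w) - (\<Inter>w\<in>K. nbhd V E w). S u = 0"
      proof
        fix u assume u: "u \<in> (\<Inter>w\<in>K - {v}. nbhd V E w) - (\<Inter>w\<in>K. nbhd V E w)"
        then have "\<forall>w\<in>K - {v}. E w u" "u \<in> V" "\<not> E v u" using sub by (auto simp: nbhd_def)
        then have "u \<notin> supp S" using v(2) by blast
        then show "S u = 0" by (simp add: supp_def)
      qed
    qed
    moreover have "(2::nat) ^ (r - 1) dvd (\<Sum>u\<in>(\<Inter>w\<in>K - {v}. nbhd V E w). S u)"
      using less.prems K4 cardK by (intro less.hyps) auto
    ultimately show ?thesis by simp
  qed
qed

section \<open>Twin classes and their parity representatives\<close>

definition twin_weight :: "'a set \<Rightarrow> ('a \<Rightarrow> 'a \<Rightarrow> bool) \<Rightarrow> ('a \<Rightarrow> nat) \<Rightarrow> 'a set \<Rightarrow> nat" where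
  "twin_weight V E S K = (\<Sum>u | u \<in> supp S \<and> nbhd V E u = K. S u)"

text \<open>The vertices of \<open>supp S\<close> adjacent to all of \<open>K\<close> are grouped by
  their exact neighbourhood \<open>L\<close>, which avoids \<open>supp S\<close> by
  independence.\<close>

lemma common_weight_eq_sum_twin_weight:
  assumes G: "simple_graph V E" and S: "supp S \<subseteq> V" "independent E (supp S)"
    and K: "K \<subseteq> V" "K \<noteq> {}"
  shows "(\<Sum>u\<in>(\<Inter>v\<in>K. nbhd V E v). S u) = (\<Sum>L | K \<subseteq> L \<and> L \<subseteq> V - supp S. twin_weight V E S L)"
proof -
  have finV: "finite V" and sym: "\<And>u v. E u v \<Longrightarrow> E v u"
    using G unfolding simple_graph_def by blast+
  have finS: "finite (supp S)" using S(1) finV by (rule finite_subset)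
  have mem: "u \<in> (\<Inter>v\<in>K. nbhd V E v) \<longleftrightarrow> K \<subseteq> nbhd V E u" if "u \<in> supp S" for u
    using that S(1) K(1) sym by (auto simp: nbhd_def)
  have sub: "(\<Inter>v\<in>K. nbhd V E v) \<subseteq> V" using K(2) by (auto simp: nbhd_def)
  have "(\<Sum>u\<in>(\<Inter>v\<in>K. nbhd V E v). S u) = (\<Sum>u | u \<in> supp S \<and> K \<subseteq> nbhd V E u. S u)"
  proof (rule sum.mono_neutral_right)
    show "finite (\<Inter>v\<in>K. nbhd V E v)" using sub finV by (rule finite_subset)
    show "{u. u \<in> supp S \<and> K \<subseteq> nbhd V E u} \<subseteq> (\<Inter>v\<in>K. nbhd V E v)" using mem by blast
    show "\<forall>u\<in>(\<Inter>v\<in>K. nbhd V E v) - {u. u \<in> supp S \<and> K \<subseteq> nbhd V E u}. S u = 0"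
    proof
      fix u assume "u \<in> (\<Inter>v\<in>K. nbhd V E v) - {u. u \<in> supp S \<and> K \<subseteq> nbhd V E u}"
      then have "u \<notin> supp S" using mem by blast
      then show "S u = 0" by (simp add: supp_def)
    qed
  qed
  also have "\<dots> = (\<Sum>L | K \<subseteq> L \<and> L \<subseteq> V - supp S. sum S {u \<in> {u. u \<in> supp S \<and> K \<subseteq> nbhd V E u}. nbhd V E u = L})"
  proof (rule sum.group[symmetric])
    show "finite {L. K \<subseteq> L \<and> L \<subseteq> V - supp S}" using finV by (auto intro: finite_subset[of _ "Pow V"])
    show "nbhd V E ` {u. u \<in> supp S \<and> K \<subseteq> nbhd V E u} \<subseteq> {L. K \<subseteq> L \<and> L \<subseteq> V - supp S}"
      using S(2) unfolding independent_def nbhd_def by auto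
  qed (use finS in simp)
  also have "\<dots> = (\<Sum>L | K \<subseteq> L \<and> L \<subseteq> V - supp S. twin_weight V E S L)"
    unfolding twin_weight_def by (intro sum.cong refl) auto
  finally show ?thesis .
qed

text \<open>Moebius inversion over the supersets of \<open>K\<close>, phrased as a downward induction.\<close>

lemma twin_weight_dvd:
  assumes m: "chord_model V E p q" and G: "simple_graph V E"
    and S: "supp S \<subseteq> V" "independent E (supp S)" "r_incident V E r S"
  shows "K \<subseteq> V - supp S \<Longrightarrow> card K \<ge> 2 \<Longrightarrow> 2 ^ (r - 1) dvd twin_weight V E S K"
proof (induction "card (V - K)" arbitrary: K rule: less_induct)
  case less
  have finV: "finite V" using G unfolding simple_graph_def by blast
  let ?U = "{L. K \<subseteq> L \<and> L \<subseteq> V - supp S}"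
  have fin: "finite ?U" using finV by (auto intro: finite_subset[of _ "Pow V"])
  have "K \<noteq> {}" "K \<subseteq> V" using less.prems by auto
  then have "(\<Sum>u\<in>(\<Inter>v\<in>K. nbhd V E v). S u) = (\<Sum>L\<in>?U. twin_weight V E S L)"
    by (intro common_weight_eq_sum_twin_weight[OF G S(1,2)])
  also have "\<dots> = twin_weight V E S K + (\<Sum>L\<in>?U - {K}. twin_weight V E S L)"
    using fin less.prems by (intro sum.remove) auto
  finally have eq: "(\<Sum>u\<in>(\<Inter>v\<in>K. nbhd V E v). S u) = twin_weight V E S K + (\<Sum>L\<in>?U - {K}. twin_weight V E S L)" .
  have "2 ^ (r - 1) dvd (\<Sum>L\<in>?U - {K}. twin_weight V E S L)"
  proof (rule dvd_sum)
    fix L assume L: "L \<in> ?U - {K}"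
    then have "card K \<le> card L" using finV by (intro card_mono) (auto intro: finite_subset)
    \<comment> \<open>A strictly larger set has a smaller complement, so the induction hypothesis
      covers every other term.\<close>
    moreover have "card (V - L) < card (V - K)" using L finV by (intro psubset_card_mono) auto
    ultimately show "2 ^ (r - 1) dvd twin_weight V E S L" using L less by auto
  qed
  moreover have "2 ^ (r - 1) dvd (\<Sum>u\<in>(\<Inter>v\<in>K. nbhd V E v). S u)"
    using less.prems by (intro common_weight_dvd[OF m G S])
  ultimately show ?case unfolding eq by (simp add: dvd_add_left_iff)
qed

text \<open>With \<open>m = 2 ^ (r - 1)\<close> this turns the condition in
  \<open>r_local_comp\<close> into a parity.\<close>

lemma mod_double_eq_iff_odd_div:
  assumes "(m::nat) dvd x" "m > 0"
  shows "x mod (2 * m) = m \<longleftrightarrow> odd (x div m)"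
proof -
  obtain k where x: "x = m * k" using assms(1) by blast
  have "x mod (2 * m) = m * (k mod 2)" unfolding x mult.commute[of 2 m] by (rule mult_mod_right[symmetric])
  then show ?thesis using assms(2) x by (auto simp: mod2_eq_if)
qed

text \<open>Modulo \<open>2 ^ r\<close>, a twin class whose weight is a multiple of
  \<open>2 ^ (r - 1)\<close> matters only through the parity of the quotient, so one vertex can
  stand for each odd class.\<close>

lemma exists_parity_representatives:
  assumes m: "chord_model V E p q" and G: "simple_graph V E" and r: "r \<ge> 1"
    and S: "supp S \<subseteq> V" "independent E (supp S)" "r_incident V E r S"
  obtains A where "A \<subseteq> supp S"
    "\<And>a b. a \<in> V \<Longrightarrow> b \<in> V \<Longrightarrow> a \<noteq> b \<Longrightarrow>
       (\<Sum>u\<in>nbhd V E a \<inter> nbhd V E b. S u) mod 2 ^ r = 2 ^ (r - 1) \<longleftrightarrow> odd (card {u \<in> A. E u a \<and> E u b})"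
proof -
  let ?M = "(2::nat) ^ (r - 1)" and ?t = "twin_weight V E S"
  have finV: "finite V" and sym: "\<And>u v. E u v \<Longrightarrow> E v u" and inV: "\<And>u v. E u v \<Longrightarrow> u \<in> V \<and> v \<in> V"
    using G unfolding simple_graph_def by blast+
  define odds where "odds = {K. K \<subseteq> V - supp S \<and> card K \<ge> 2 \<and> odd (?t K div ?M)}"
  \<comment> \<open>An odd quotient is nonzero, so the class has a vertex to choose.\<close>
  have "\<exists>u. u \<in> supp S \<and> nbhd V E u = K" if "K \<in> odds" for K
  proof (rule ccontr)
    assume "\<nexists>u. u \<in> supp S \<and> nbhd V E u = K"
    then have "?t K = 0" unfolding twin_weight_def by (intro sum.neutral) auto
    then show False using that by (simp add: odds_def)
  qed
  then obtain h where h: "\<And>K. K \<in> odds \<Longrightarrow> h K \<in> supp S \<and> nbhd V E (h K) = K" by metis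
  have hinj: "inj_on h odds" by (rule inj_onI) (metis h)
  define A where "A = h ` odds"
  have A: "A \<subseteq> supp S" using h by (auto simp: A_def)
  have hE: "E (h K) a \<longleftrightarrow> a \<in> K" if "K \<in> odds" for K a
    using h[OF that] inV by (auto simp: nbhd_def)
  have "(\<Sum>u\<in>nbhd V E a \<inter> nbhd V E b. S u) mod 2 ^ r = ?M \<longleftrightarrow> odd (card {u \<in> A. E u a \<and> E u b})"
    if ab: "a \<in> V" "b \<in> V" "a \<noteq> b" for a b
  \<comment> \<open>If \<open>a\<close> or \<open>b\<close> is in \<open>supp S\<close>,
    independence leaves no common neighbour there: the weight and the count are both 0.\<close>
  proof (cases "a \<in> supp S \<or> b \<in> supp S")
    case True
    then have "S u = 0" if "u \<in> nbhd V E a \<inter> nbhd V E b" for u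
    proof -
      have "u \<notin> supp S" using True that S(2) unfolding independent_def nbhd_def by blast
      then show ?thesis by (simp add: supp_def)
    qed
    then have "(\<Sum>u\<in>nbhd V E a \<inter> nbhd V E b. S u) = 0" by (intro sum.neutral) blast
    moreover have "{u \<in> A. E u a \<and> E u b} = {}"
      using True A S(2) unfolding independent_def by blast
    ultimately show ?thesis by (simp only: card.empty) simp
  next
    case False
    let ?U = "{L. {a, b} \<subseteq> L \<and> L \<subseteq> V - supp S}"
    have fin: "finite ?U" using finV by (auto intro: finite_subset[of _ "Pow V"])
    have dv: "?M dvd ?t L" and c2: "card L \<ge> 2" if "L \<in> ?U" for L
    proof -
      have "card {a, b} \<le> card L" using that finV by (intro card_mono) (auto intro: finite_subset)
      then show "card L \<ge> 2" using ab by simp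
      then show "?M dvd ?t L" using that by (intro twin_weight_dvd[OF m G S]) auto
    qed
    let ?w = "\<Sum>u\<in>nbhd V E a \<inter> nbhd V E b. S u"
    have w: "?w = (\<Sum>L\<in>?U. ?t L)"
      using common_weight_eq_sum_twin_weight[OF G S(1,2), of "{a, b}"] ab by simp
    have "?M dvd ?w" unfolding w using dv by (intro dvd_sum) blast
    moreover have "2 ^ r = 2 * ?M" using r by (simp flip: power_Suc)
    ultimately have "?w mod 2 ^ r = ?M \<longleftrightarrow> odd (?w div ?M)"
      using mod_double_eq_iff_odd_div[of ?M ?w] by simp
    also have "?w div ?M = (\<Sum>L\<in>?U. ?t L div ?M)"
    proof -
      have "?w = (\<Sum>L\<in>?U. ?M * (?t L div ?M))"
        unfolding w using dv by (intro sum.cong refl) simp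
      then show ?thesis by (simp flip: sum_distrib_left)
    qed
    \<comment> \<open>The parity of a sum is that of the number of its odd terms; \<open>h\<close>
      then matches these classes with vertices of \<open>A\<close>.\<close>
    also have "odd (\<Sum>L\<in>?U. ?t L div ?M) \<longleftrightarrow> odd (card {L \<in> ?U. odd (?t L div ?M)})"
      using even_sum_iff[OF fin, of "\<lambda>L. ?t L div ?M"] by blast
    also have "{L \<in> ?U. odd (?t L div ?M)} = {L \<in> odds. a \<in> L \<and> b \<in> L}"
      using c2 by (auto simp: odds_def)
    also have "card {L \<in> odds. a \<in> L \<and> b \<in> L} = card (h ` {L \<in> odds. a \<in> L \<and> b \<in> L})"
      using hinj by (intro card_image[symmetric]) (auto intro: inj_on_subset)
    also have "h ` {L \<in> odds. a \<in> L \<and> b \<in> L} = {u \<in> A. E u a \<and> E u b}"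
      unfolding A_def using hE by auto
    finally show ?thesis .
  qed
  with A show thesis by (rule that)
qed

section \<open>Iterated local complementation\<close>

lemma local_comp_list_independent:
  assumes "distinct xs" "independent E (set xs)" "\<And>u v. E u v \<Longrightarrow> E v u"
  shows "local_comp_list E xs a b \<longleftrightarrow>
     (E a b \<noteq> (a \<noteq> b \<and> odd (card {u \<in> set xs. E u a \<and> E u b})))"
  using assms
proof (induction xs arbitrary: E)
  case Nil
  then show ?case by (simp add: local_comp_list_def)
next
  case (Cons x xs)
  let ?F = "local_comp E x"
  \<comment> \<open>Independence makes \<open>x\<close> non-adjacent to \<open>u\<close>, so
    complementing at \<open>x\<close> leaves the neighbourhood of \<open>u\<close> intact; each
    later step toggles the same pairs as in \<open>E\<close>.\<close>
  have F: "?F u v \<longleftrightarrow> E u v" if "u \<in> set xs" for u v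
    using Cons.prems(2) that unfolding independent_def local_comp_def by auto
  have "local_comp_list E (x # xs) a b \<longleftrightarrow> local_comp_list ?F xs a b"
    by (simp add: local_comp_list_def)
  also have "\<dots> \<longleftrightarrow> (?F a b \<noteq> (a \<noteq> b \<and> odd (card {u \<in> set xs. ?F u a \<and> ?F u b})))"
  proof (rule Cons.IH)
    show "distinct xs" using Cons.prems by simp
    show "independent ?F (set xs)" using Cons.prems(2) F unfolding independent_def by auto
    show "?F v u" if "?F u v" for u v using that Cons.prems(3) unfolding local_comp_def by metis
  qed
  also have "{u \<in> set xs. ?F u a \<and> ?F u b} = {u \<in> set xs. E u a \<and> E u b}" using F by blast
  also have "(?F a b \<noteq> (a \<noteq> b \<and> odd (card {u \<in> set xs. E u a \<and> E u b}))) \<longleftrightarrow>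
     (E a b \<noteq> (a \<noteq> b \<and> odd (card {u \<in> set (x # xs). E u a \<and> E u b})))"
  proof (cases "E x a \<and> E x b")
    case True
    then have "{u \<in> set (x # xs). E u a \<and> E u b} = insert x {u \<in> set xs. E u a \<and> E u b}" by auto
    then have "card {u \<in> set (x # xs). E u a \<and> E u b} = Suc (card {u \<in> set xs. E u a \<and> E u b})"
      using Cons.prems(1) by simp
    then show ?thesis using True by (auto simp: local_comp_def)
  next
    case False
    then have "{u \<in> set (x # xs). E u a \<and> E u b} = {u \<in> set xs. E u a \<and> E u b}" by auto
    then show ?thesis using False by (auto simp: local_comp_def)
  qed
  finally show ?case .
qed

lemma chord_model_local_comp_list:
  assumes "chord_model V E p q" "set xs \<subseteq> V" "\<And>u. \<not> E u u"
  shows "\<exists>p q. chord_model V (local_comp_list E xs) p q"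
  using assms
proof (induction xs arbitrary: E p q)
  case Nil
  then show ?case by (auto simp: local_comp_list_def)
next
  case (Cons x xs)
  have "chord_model V (local_comp E x) (flip (p x) (q x) \<circ> p) (flip (p x) (q x) \<circ> q)"
    using Cons.prems by (intro chord_model_local_comp) auto
  moreover have "\<not> local_comp E x u u" for u using Cons.prems(3) by (simp add: local_comp_def)
  ultimately have "\<exists>p q. chord_model V (local_comp_list (local_comp E x) xs) p q"
    using Cons.prems(2) by (intro Cons.IH) auto
  then show ?case by (simp add: local_comp_list_def)
qed

theorem mainTheorem3:
  fixes V :: "'a set" and E :: "'a \<Rightarrow> 'a \<Rightarrow> bool" and r :: nat and S :: "'a \<Rightarrow> nat"
  assumes "simple_graph V E"
    and "circle_graph V E"
    and "r \<ge> 1"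
    and "supp S \<subseteq> V"
    and "independent E (supp S)"
    and "r_incident V E r S"
  shows "\<exists>A. A \<subseteq> V \<and> independent E A \<and>
           (\<forall>xs. distinct xs \<and> set xs = A \<longrightarrow> r_local_comp V E r S = local_comp_list E xs)
         \<and> circle_graph V (r_local_comp V E r S)"
proof -
  have finV: "finite V" and sym: "\<And>u v. E u v \<Longrightarrow> E v u" and irr: "\<And>u. \<not> E u u"
    and inV: "\<And>u v. E u v \<Longrightarrow> u \<in> V \<and> v \<in> V"
    using assms(1) unfolding simple_graph_def by blast+
  obtain p q where m: "chord_model V E p q"
    using assms(2) finV by (rule chord_model_of_circle_graph)
  obtain A where A: "A \<subseteq> supp S"
    and par: "\<And>a b. a \<in> V \<Longrightarrow> b \<in> V \<Longrightarrow> a \<noteq> b \<Longrightarrow>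
       (\<Sum>u\<in>nbhd V E a \<inter> nbhd V E b. S u) mod 2 ^ r = 2 ^ (r - 1) \<longleftrightarrow> odd (card {u \<in> A. E u a \<and> E u b})"
    using exists_parity_representatives[OF m assms(1,3-6)] by blast
  have AV: "A \<subseteq> V" using A assms(4) by blast
  have ind: "independent E A" using A assms(5) unfolding independent_def by blast
  have eq: "r_local_comp V E r S = local_comp_list E xs" if xs: "distinct xs" "set xs = A" for xs
  proof (intro ext)
    fix a b
    have L: "local_comp_list E xs a b \<longleftrightarrow> (E a b \<noteq> (a \<noteq> b \<and> odd (card {u \<in> A. E u a \<and> E u b})))"
      using local_comp_list_independent[of xs E a b] xs ind sym by simp
    show "r_local_comp V E r S a b = local_comp_list E xs a b"
    proof (cases "a \<in> V \<and> b \<in> V \<and> a \<noteq> b")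
      case True
      then show ?thesis unfolding L r_local_comp_def using par by simp
    next
      \<comment> \<open>The equality concerns all pairs of the type: on the diagonal and outside
        \<open>V\<close> both relations are false.\<close>
      case False
      then have "a = b \<or> {u \<in> A. E u a \<and> E u b} = {}" using inV by blast
      then have "\<not> (a \<noteq> b \<and> odd (card {u \<in> A. E u a \<and> E u b}))" by force
      moreover have "\<not> E a b" using False inV irr by blast
      ultimately show ?thesis unfolding L r_local_comp_def using False by blast
    qed
  qed
  obtain xs where xs: "distinct xs" "set xs = A"
    using finite_distinct_list[OF finite_subset[OF AV finV]] by blast
  then obtain p' q' where "chord_model V (local_comp_list E xs) p' q'"
    using chord_model_local_comp_list[OF m _ irr, of xs] AV by blast
  then have "circle_graph V (r_local_comp V E r S)"
    unfolding eq[OF xs] by (rule circle_graph_of_chord_model)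
  then show ?thesis using AV ind eq by blast
qed

end
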